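(* Let $(X,\mathbb{X},\mu)$ be a measure space, let $p\in[1,\infty)$, and let $f_n$ ($n\in\mathbb{N}$) and $f$ be measurable functions on $X$. If $(f_n)$ $\alpha_p$-converges to $f$, then $(f_n)$ converges to $f$ in measure. On the other hand, if $\mu(X)<\infty$ and $(f_n)$ converges to $f$ in measure, then $(f_n)$ $\alpha_p$-converges to $f$.
   Context: A measurable function is a real-valued $\mu$-measurable function defined on $X$ (functions are identified when equal $\mu$-a.e.). For $A\subseteq X$, $A^c$ denotes the complement of $A$ in $X$. A sequence $(f_n)$ of measurable functions asymptotically $L_p$-converges (in short, $\alpha_p$-converges) to a measurable function $f$ if there exists a sequence of measurable sets $(B_n)$ with $\mu(B_n^c)\to 0$ as $n\to\infty$ such that $\int_{B_n}|f_n-f|^p\,\mathrm{d}\mu\to 0$ as $n\to\infty$. A sequence $(f_n)$ of measurable functions converges in measure to a measurable function $f$ if for every $\delta>0$, $\mu(\{x\in X \mid |f_n(x)-f(x)|\ge\delta\})\to 0$ as $n\to\infty$. *)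

theory Defs
  imports "HOL-Analysis.Analysis"
begin

text \<open>
  Measurability of the functions is not part of the two convergence notions below; it is a separate
  hypothesis wherever they are used. Measures and integrals of nonnegative functions take values
  in \<^typ>\<open>ennreal\<close>, so no finiteness or integrability is presupposed: with the Bochner integral
  or \<^const>\<open>measure\<close> an infinite value would silently count as 0.
\<close>

definition alpha_converges ::
    "real \<Rightarrow> 'a measure \<Rightarrow> (nat \<Rightarrow> 'a \<Rightarrow> real) \<Rightarrow> ('a \<Rightarrow> real) \<Rightarrow> bool" where
  "alpha_converges p M F f \<longleftrightarrow>
     (\<exists>B :: nat \<Rightarrow> 'a set.
        (\<forall>n. B n \<in> sets M) \<and>
        (\<lambda>n. emeasure M (space M - B n)) \<longlonglongrightarrow> 0 \<and>
        (\<lambda>n. \<integral>\<^sup>+x\<in>B n. ennreal (\<bar>F n x - f x\<bar> powr p) \<partial>M) \<longlonglongrightarrow> 0)"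

definition converges_in_measure ::
    "'a measure \<Rightarrow> (nat \<Rightarrow> 'a \<Rightarrow> real) \<Rightarrow> ('a \<Rightarrow> real) \<Rightarrow> bool" where
  "converges_in_measure M F f \<longleftrightarrow>
     (\<forall>\<delta>>0. (\<lambda>n. emeasure M {x \<in> space M. \<bar>F n x - f x\<bar> \<ge> \<delta>}) \<longlonglongrightarrow> 0)"

end

theory Submission
  imports Defs
begin

text \<open>
  Asymptotic \<open>L\<^sub>p\<close>-convergence implies convergence in measure by Markov's inequality on \<open>B n\<close>:
  the part of \<open>{\<bar>F n - f\<bar> \<ge> \<delta>}\<close> inside \<open>B n\<close> has measure at most \<open>\<delta>\<close> to the power \<open>-p\<close> times
  the integral over \<open>B n\<close>, and the part outside is controlled by the complement of \<open>B n\<close>.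

  Conversely, convergence in measure says that every fixed threshold is eventually exceeded only
  on a small set. A diagonal argument lets the threshold \<open>\<epsilon> n\<close> tend to zero with \<open>n\<close> while
  the exceptional sets still have vanishing measure. With \<open>B n = {\<bar>F n - f\<bar> < \<epsilon> n}\<close> the integral
  over \<open>B n\<close> is at most \<open>\<epsilon> n powr p\<close> times the measure of the whole space, which vanishes in the
  limit because that measure is finite.
\<close>

text \<open>The index \<open>k n\<close> is the largest \<open>j \<le> n\<close> for which \<open>P j n\<close> holds. Each fixed \<open>j\<close> is
  eventually a candidate, so \<open>k n\<close> outgrows it.\<close>

lemma eventually_diagonal_index:
  fixes P :: "nat \<Rightarrow> nat \<Rightarrow> bool"
  assumes "\<And>j. eventually (P j) sequentially"
  obtains k where "filterlim k at_top sequentially" "eventually (\<lambda>n. P (k n) n) sequentially"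
proof -
  define k where "k n = Max {j. j \<le> n \<and> P j n}" for n
  have fin: "finite {j. j \<le> n \<and> P j n}" for n
    by (rule finite_subset[of _ "{..n}"]) auto
  have ev: "eventually (\<lambda>n. j \<le> k n \<and> P (k n) n) sequentially" for j
    using assms[of j] eventually_ge_at_top[of j]
  proof eventually_elim
    case (elim n)
    then have j: "j \<in> {j. j \<le> n \<and> P j n}" by simp
    then have "k n \<in> {j. j \<le> n \<and> P j n}"
      unfolding k_def using Max_in[OF fin] by blast
    with Max_ge[OF fin j] show ?case by (simp add: k_def)
  qed
  show thesis
  proof (rule that)
    show "filterlim k at_top sequentially"
      unfolding filterlim_at_top using ev by (simp add: eventually_conj_iff)
    show "eventually (\<lambda>n. P (k n) n) sequentially"
      using ev[of 0] by (auto elim: eventually_mono)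
  qed
qed

lemma ennreal_tendsto_0_mono:
  fixes u v :: "'b \<Rightarrow> ennreal"
  assumes "eventually (\<lambda>n. u n \<le> v n) A" and "(v \<longlongrightarrow> 0) A"
  shows "(u \<longlongrightarrow> 0) A"
  by (rule tendsto_sandwich[OF _ assms(1) tendsto_const assms(2)]) simp

text \<open>
  For each fixed \<open>j\<close>, the set where the deviation is at least \<open>d j = 1 / (j + 1)\<close> has measure
  below \<open>d j\<close> once \<open>n\<close> is large. Using \<open>d j\<close> both as threshold and as bound on the measure
  makes a single diagonal index sequence drive both to zero.
\<close>

lemma converges_in_measure_vanishing_threshold:
  assumes "converges_in_measure M F f"
  obtains \<epsilon> :: "nat \<Rightarrow> real" where "\<And>n. 0 < \<epsilon> n" "\<epsilon> \<longlonglongrightarrow> 0"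
    "(\<lambda>n. emeasure M {x \<in> space M. \<epsilon> n \<le> \<bar>F n x - f x\<bar>}) \<longlonglongrightarrow> 0"
proof -
  define d :: "nat \<Rightarrow> real" where "d j = inverse (real (Suc j))" for j
  have d_pos: "0 < d j" for j by (simp add: d_def)
  have d_lim: "d \<longlonglongrightarrow> 0"
    unfolding d_def by (rule LIMSEQ_inverse_real_of_nat)
  have "eventually (\<lambda>n. emeasure M {x \<in> space M. d j \<le> \<bar>F n x - f x\<bar>} < ennreal (d j)) sequentially"
    for j
    using assms d_pos[of j] unfolding converges_in_measure_def
    by (intro order_tendstoD(2)) auto
  then obtain k where k: "filterlim k at_top sequentially" and
    small: "eventually (\<lambda>n. emeasure M {x \<in> space M. d (k n) \<le> \<bar>F n x - f x\<bar>} < ennreal (d (k n))) sequentially"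
    by (rule eventually_diagonal_index)
  have dk: "(\<lambda>n. d (k n)) \<longlonglongrightarrow> 0"
    using d_lim k by (rule filterlim_compose)
  have "(\<lambda>n. emeasure M {x \<in> space M. d (k n) \<le> \<bar>F n x - f x\<bar>}) \<longlonglongrightarrow> 0"
  proof (rule ennreal_tendsto_0_mono)
    show "(\<lambda>n. ennreal (d (k n))) \<longlonglongrightarrow> 0"
      using tendsto_ennrealI[OF dk] by simp
    show "eventually (\<lambda>n. emeasure M {x \<in> space M. d (k n) \<le> \<bar>F n x - f x\<bar>} \<le> ennreal (d (k n))) sequentially"
      using small by (auto elim: eventually_mono)
  qed
  with d_pos dk show thesis by (intro that)
qed

text \<open>
  The bound on the exceptional set is a sum of two vanishing terms because the Markov constant
  \<open>\<delta>\<close> to the power \<open>-p\<close> is finite and does not depend on \<open>n\<close>.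
\<close>

lemma alpha_converges_imp_converges_in_measure:
  assumes p: "0 < p" and [measurable]: "\<And>n. F n \<in> borel_measurable M" "f \<in> borel_measurable M"
    and alpha: "alpha_converges p M F f"
  shows "converges_in_measure M F f"
  unfolding converges_in_measure_def
proof (intro allI impI)
  fix \<delta> :: real assume \<delta>: "0 < \<delta>"
  obtain B where B [measurable]: "\<And>n. B n \<in> sets M"
    and compl: "(\<lambda>n. emeasure M (space M - B n)) \<longlonglongrightarrow> 0"
    and int: "(\<lambda>n. \<integral>\<^sup>+x\<in>B n. ennreal (\<bar>F n x - f x\<bar> powr p) \<partial>M) \<longlonglongrightarrow> 0"
    using alpha unfolding alpha_converges_def by blast
  define c where "c = ennreal (inverse (\<delta> powr p))"
  have bound: "emeasure M {x \<in> space M. \<delta> \<le> \<bar>F n x - f x\<bar>}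
      \<le> emeasure M (space M - B n) + c * (\<integral>\<^sup>+x\<in>B n. ennreal (\<bar>F n x - f x\<bar> powr p) \<partial>M)" for n
  proof -
    let ?u = "\<lambda>x. ennreal (\<bar>F n x - f x\<bar> powr p)"
    have one: "1 \<le> c * ?u x" if "\<delta> \<le> \<bar>F n x - f x\<bar>" for x
    proof -
      have "\<delta> powr p \<le> \<bar>F n x - f x\<bar> powr p"
        using that \<delta> p by (intro powr_mono2) auto
      then have "1 \<le> inverse (\<delta> powr p) * \<bar>F n x - f x\<bar> powr p"
        using \<delta> by (simp add: field_simps)
      then show ?thesis
        unfolding c_def by (subst ennreal_mult[symmetric]) auto
    qed
    have "emeasure M {x \<in> space M. \<delta> \<le> \<bar>F n x - f x\<bar>}
        \<le> emeasure M ((space M - B n) \<union> {x \<in> B n. 1 \<le> c * ?u x})"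
      using one by (intro emeasure_mono) (auto dest: sets.sets_into_space[OF B, THEN subsetD])
    also have "\<dots> \<le> emeasure M (space M - B n) + emeasure M {x \<in> B n. 1 \<le> c * ?u x}"
      by (intro emeasure_subadditive) auto
    also have "\<dots> \<le> emeasure M (space M - B n) + c * (\<integral>\<^sup>+x\<in>B n. ?u x \<partial>M)"
      by (intro add_left_mono nn_integral_Markov_inequality) auto
    finally show ?thesis .
  qed
  have "(\<lambda>n. emeasure M (space M - B n) + c * (\<integral>\<^sup>+x\<in>B n. ennreal (\<bar>F n x - f x\<bar> powr p) \<partial>M))
      \<longlonglongrightarrow> 0 + c * 0"
    using compl int by (intro tendsto_add ennreal_tendsto_cmult) (auto simp: c_def)
  then show "(\<lambda>n. emeasure M {x \<in> space M. \<delta> \<le> \<bar>F n x - f x\<bar>}) \<longlonglongrightarrow> 0"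
    by (intro ennreal_tendsto_0_mono[OF always_eventually[OF allI[OF bound]]]) simp
qed

text \<open>
  A fixed threshold would only bound the integrals by a positive constant. The vanishing threshold
  makes that bound tend to zero, but only against a finite total measure, since
  \<open>\<infinity> * ennreal (\<epsilon> n powr p) = \<infinity>\<close> for every \<open>n\<close>.
\<close>

lemma converges_in_measure_imp_alpha_converges:
  assumes p: "0 < p" and [measurable]: "\<And>n. F n \<in> borel_measurable M" "f \<in> borel_measurable M"
    and finite: "emeasure M (space M) < \<infinity>"
    and conv: "converges_in_measure M F f"
  shows "alpha_converges p M F f"
proof -
  obtain \<epsilon> :: "nat \<Rightarrow> real" where pos: "\<And>n. 0 < \<epsilon> n" and lim: "\<epsilon> \<longlonglongrightarrow> 0"
    and exc: "(\<lambda>n. emeasure M {x \<in> space M. \<epsilon> n \<le> \<bar>F n x - f x\<bar>}) \<longlonglongrightarrow> 0"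
    using conv by (rule converges_in_measure_vanishing_threshold) blast
  define B where "B n = {x \<in> space M. \<bar>F n x - f x\<bar> < \<epsilon> n}" for n
  have B [measurable]: "B n \<in> sets M" for n
    unfolding B_def by measurable
  have compl: "space M - B n = {x \<in> space M. \<epsilon> n \<le> \<bar>F n x - f x\<bar>}" for n
    by (auto simp: B_def)
  have bound: "(\<integral>\<^sup>+x\<in>B n. ennreal (\<bar>F n x - f x\<bar> powr p) \<partial>M)
      \<le> emeasure M (space M) * ennreal (\<epsilon> n powr p)" for n
  proof -
    have "(\<integral>\<^sup>+x\<in>B n. ennreal (\<bar>F n x - f x\<bar> powr p) \<partial>M) \<le> (\<integral>\<^sup>+x. ennreal (\<epsilon> n powr p) \<partial>M)"
      using p by (intro nn_integral_mono)
        (auto simp: B_def indicator_def intro!: ennreal_leI powr_mono2)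
    then show ?thesis by (simp add: mult.commute)
  qed
  have "(\<lambda>n. \<epsilon> n powr p) \<longlonglongrightarrow> 0 powr p"
    using lim p pos by (intro tendsto_powr2 tendsto_const) (auto simp: less_imp_le)
  then have "(\<lambda>n. emeasure M (space M) * ennreal (\<epsilon> n powr p)) \<longlonglongrightarrow> emeasure M (space M) * 0"
    using finite tendsto_ennrealI[of "\<lambda>n. \<epsilon> n powr p" 0] p
    by (intro ennreal_tendsto_cmult) auto
  then have "(\<lambda>n. \<integral>\<^sup>+x\<in>B n. ennreal (\<bar>F n x - f x\<bar> powr p) \<partial>M) \<longlonglongrightarrow> 0"
    by (intro ennreal_tendsto_0_mono[OF always_eventually[OF allI[OF bound]]]) simp
  then show ?thesis
    unfolding alpha_converges_def using B exc compl by (intro exI[of _ B]) simp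
qed

theorem theorem1p1:
  fixes M :: "'a measure" and p :: real
    and F :: "nat \<Rightarrow> 'a \<Rightarrow> real" and f :: "'a \<Rightarrow> real"
  assumes "1 \<le> p"
    and "\<And>n. F n \<in> borel_measurable M"
    and "f \<in> borel_measurable M"
  shows "(alpha_converges p M F f \<longrightarrow> converges_in_measure M F f) \<and>
         (emeasure M (space M) < \<infinity> \<and> converges_in_measure M F f \<longrightarrow> alpha_converges p M F f)"
  using assms alpha_converges_imp_converges_in_measure[of p F M f]
    converges_in_measure_imp_alpha_converges[of p F M f]
  by simp

end
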